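(* Let $(M,S,\eta)$ be a factorable monoid and let $\varphi$ be the restriction of $\eta\mu$ to $S^2$. If the equality $\varphi_1\varphi_2\varphi_1\varphi_2(r,s,t)=\varphi_2\varphi_1\varphi_2(r,s,t)$ holds for each $(r,s,t)\in S_+^3$ such that $\varphi_2\varphi_1\varphi_2(r,s,t)$ contains $1$, then $(S,N'_\varphi)$ is a quadratic normalisation of class $(4,3)$ mod $1$ for $M$.
   Context: Notation. $M$ is a monoid with multiplication $\mu:M^2\to M$, $S\subseteq M$ is a generating subset with $1\in S$, and $S_+=S\setminus\{1\}$. $S^*$ is the free monoid over $S$; its elements are words $(s_1,\ldots,s_n)=s_1|\cdots|s_n$; $|w|$ is the length of a word. For $f\in M$, $|f|$ is the minimal length of an $S$-word representing $f$ (so $|1|=0$). For a set $A$ and $F:A^2\to A^2$, $F_i$ applies $F$ to the entries at positions $i,i+1$ of a word over $A$ (counted from the left). Compositions are read with the rightmost map applied first. Factorability. A factorisation map for $(M,S)$ is a map $\eta=(\eta',\overline{\eta}):M\to M^2$ with $\eta(1)=(1,1)$ and, for every $f\ne1$: $\eta'(f)\in S_+$, $\eta'(f)\cdot\overline{\eta}(f)=f$, $|f|=|\eta'(f)|+|\overline{\eta}(f)|$. It is a factorability structure, and $(M,S,\eta)$ is a factorable monoid, if, with $F=\eta\circ\mu$, for every triple in $M^3$ either $F_1F_2F_1F_2$, $F_2F_1F_2$, $F_2F_1F_2F_1$ take the same value on it or each of these three maps strictly reduces the sum of the lengths of the entries. The restriction $\varphi$ of $\eta\mu$ to $S^2$ takes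 values in $S^2$. The maps $N_\varphi$ and $N'_\varphi$. For $w\in S^*$ put $T_\varphi(w)=\varphi_{|w|-1}\cdots\varphi_1(w)$ ($T_\varphi(w)=w$ if $|w|=1$). $N_\varphi:S^*\to S^*$ is defined recursively: $N_\varphi$ of the empty word is empty; $N_\varphi$ of a word containing the letter $1$ equals $N_\varphi$ of the word with $1$ removed; for $s_1,\ldots,s_n\in S_+$, putting $v=T_\varphi(s_1|N_\varphi(s_2,\ldots,s_n))$, $N_\varphi(s_1,\ldots,s_n)=v$ if $v$ contains no $1$, and $=N_\varphi(v)$ otherwise. Then $N'_\varphi(w)=N_\varphi(w)|1^m$ with $m=|w|-|N_\varphi(w)|$. Normalisation. A normalisation is a pair $(A,N)$ with $N:A^*\to A^*$ length-preserving, identity on one-letter words, and $N(u|v|w)=N(u|N(v)|w)$ for all words $u,v,w$; $w$ is $N$-normal if $N(w)=w$; $\overline{N}$ is the restriction of $N$ to length-two words. $(A,N)$ is quadratic if a word is $N$-normal iff all its length-two factors are, and for each word $w$ there is a finite sequence of positions $(i_1,\ldots,i_k)$ with $N(w)=\overline{N}_{i_k}\cdots\overline{N}_{i_1}(w)$. $e\in A$ is $N$-neutral if $N(w|e)=N(e|w)=N(w)|e$ for all $w$. $(S,N)$ is a normalisation mod $1$ for $M$ if $1\in S$ is $N$-neutral and $M$ is presented (via the inclusion $S\subseteq M$) by $\langle S\mid\{w=N(w):w\in S^*\}\cup\{1_S=1\}\rangle$, where $1_S$ is the letter $1$ of $S$. Class. A quadratic normalisation $(A,N)$ is of left-class $m$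 (resp. right-class $n$) if for every length-three word $w$, $N(w)$ is obtained from $w$ by applying alternately $\overline{N}_1,\overline{N}_2,\overline{N}_1,\ldots$ ($m$ maps in total, $\overline{N}_1$ first) (resp. $\overline{N}_2,\overline{N}_1,\overline{N}_2,\ldots$, $n$ maps in total, $\overline{N}_2$ first). It is of class $(m,n)$ if it is of left-class $m$ and right-class $n$. *)

theory Defs
  imports Main "HOL-Library.FuncSet"
begin

text \<open>
  The monoid \<open>M\<close> is the whole of a type of class \<open>monoid_mult\<close>, words over \<open>A\<close> are the members
  of \<^term>\<open>lists A\<close>, and \<^term>\<open>prod_list\<close> evaluates a word in \<open>M\<close>.
\<close>

text \<open>
  \<open>app_at F i\<close> is the map usually written \<open>F\<close> with index \<open>i\<close>; positions are counted from 1.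
  It is the identity when \<open>i\<close>, \<open>i + 1\<close> are not both positions of the word.
\<close>

definition app_at :: "('a \<times> 'a \<Rightarrow> 'a \<times> 'a) \<Rightarrow> nat \<Rightarrow> 'a list \<Rightarrow> 'a list" where
  "app_at F i w =
     (if 1 \<le> i \<and> i < length w
      then (case F (w ! (i - 1), w ! i) of (a, b) \<Rightarrow> w[i - 1 := a, i := b])
      else w)"

text \<open>The first listed position is applied first.\<close>

definition app_seq :: "('a \<times> 'a \<Rightarrow> 'a \<times> 'a) \<Rightarrow> nat list \<Rightarrow> 'a list \<Rightarrow> 'a list" where
  "app_seq F is w = fold (app_at F) is w"

lemma length_app_at [simp]: "length (app_at F i w) = length w"
  by (simp add: app_at_def split: prod.split)

lemma length_app_seq [simp]: "length (app_seq F is w) = length w"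
  unfolding app_seq_def by (induction "is" arbitrary: w) simp_all


subsection \<open>Factorability\<close>

definition generates :: "'a::monoid_mult set \<Rightarrow> bool" where
  "generates S \<longleftrightarrow> (\<forall>f. \<exists>w\<in>lists S. prod_list w = f)"

definition wlen :: "'a::monoid_mult set \<Rightarrow> 'a \<Rightarrow> nat" where
  "wlen S f = (LEAST n. \<exists>w\<in>lists S. length w = n \<and> prod_list w = f)"

definition factorisation_map :: "'a::monoid_mult set \<Rightarrow> ('a \<Rightarrow> 'a \<times> 'a) \<Rightarrow> bool" where
  "factorisation_map S \<eta> \<longleftrightarrow>
     \<eta> 1 = (1, 1) \<and>
     (\<forall>f. f \<noteq> 1 \<longrightarrow>
        fst (\<eta> f) \<in> S - {1} \<and>
        fst (\<eta> f) * snd (\<eta> f) = f \<and>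
        wlen S f = wlen S (fst (\<eta> f)) + wlen S (snd (\<eta> f)))"

definition mult_pair :: "'a::monoid_mult \<times> 'a \<Rightarrow> 'a" where
  "mult_pair = (\<lambda>(f, g). f * g)"

definition total_wlen :: "'a::monoid_mult set \<Rightarrow> 'a list \<Rightarrow> nat" where
  "total_wlen S x = (\<Sum>f\<leftarrow>x. wlen S f)"

definition factorability_structure :: "'a::monoid_mult set \<Rightarrow> ('a \<Rightarrow> 'a \<times> 'a) \<Rightarrow> bool" where
  "factorability_structure S \<eta> \<longleftrightarrow>
     factorisation_map S \<eta> \<and>
     (let F1 = app_at (\<eta> \<circ> mult_pair) 1; F2 = app_at (\<eta> \<circ> mult_pair) 2 in
      \<forall>x. length x = 3 \<longrightarrow>
        (F1 (F2 (F1 (F2 x))) = F2 (F1 (F2 x)) \<and>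
         F2 (F1 (F2 x)) = F2 (F1 (F2 (F1 x)))) \<or>
        (total_wlen S (F1 (F2 (F1 (F2 x)))) < total_wlen S x \<and>
         total_wlen S (F2 (F1 (F2 x))) < total_wlen S x \<and>
         total_wlen S (F2 (F1 (F2 (F1 x)))) < total_wlen S x))"

definition factorable_monoid :: "'a::monoid_mult set \<Rightarrow> ('a \<Rightarrow> 'a \<times> 'a) \<Rightarrow> bool" where
  "factorable_monoid S \<eta> \<longleftrightarrow> 1 \<in> S \<and> generates S \<and> factorability_structure S \<eta>"


subsection \<open>The normalisation maps of a map on pairs\<close>

definition T_map :: "('a \<times> 'a \<Rightarrow> 'a \<times> 'a) \<Rightarrow> 'a list \<Rightarrow> 'a list" where
  "T_map \<phi> w = app_seq \<phi> [1..<length w] w"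

lemma length_T_map [simp]: "length (T_map \<phi> w) = length w"
  by (simp add: T_map_def)

text \<open>
  The recursion ends for every \<open>\<phi>\<close>: \<^term>\<open>T_map \<phi>\<close> preserves length, the result is never
  longer than the argument, and a word containing \<open>1\<close> gets shorter when \<open>1\<close> is removed.
\<close>

function N_map :: "('a::one \<times> 'a \<Rightarrow> 'a \<times> 'a) \<Rightarrow> 'a list \<Rightarrow> 'a list" where
  "N_map \<phi> [] = []"
| "N_map \<phi> (s # w) =
     (if 1 \<in> set (s # w) then N_map \<phi> (removeAll 1 (s # w))
      else let v = T_map \<phi> (s # N_map \<phi> w) in
           if 1 \<in> set v then N_map \<phi> v else v)"
  by pat_completeness auto

lemma N_map_length_partial: "N_map_dom (\<phi>, w) \<Longrightarrow> length (N_map \<phi> w) \<le> length w"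
proof (induction rule: N_map.pinduct)
  case (1 \<phi>)
  then show ?case by (simp add: N_map.psimps)
next
  case (2 \<phi> s w)
  show ?case
  proof (cases "1 \<in> set (s # w)")
    case True
    then have "length (N_map \<phi> (s # w)) = length (N_map \<phi> (removeAll 1 (s # w)))"
      using 2(1) by (simp add: N_map.psimps)
    also have "\<dots> \<le> length (removeAll 1 (s # w))"
      using 2(2) True by blast
    also have "\<dots> \<le> length (s # w)"
      by (rule length_removeAll_less_eq)
    finally show ?thesis .
  next
    case False
    define v where "v = T_map \<phi> (s # N_map \<phi> w)"
    have v: "length v \<le> length (s # w)"
      using 2(3) False by (simp add: v_def)
    have "1 \<in> set v \<Longrightarrow> length (N_map \<phi> v) \<le> length v"
      using 2(4)[OF False v_def] by blast
    moreover have "N_map \<phi> (s # w) = (if 1 \<in> set v then N_map \<phi> v else v)"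
      using 2(1) False by (simp add: N_map.psimps v_def Let_def)
    ultimately show ?thesis using v by auto
  qed
qed

termination N_map
proof (relation "measure (\<lambda>(\<phi>, w). length (removeAll 1 w) + length w)", goal_cases)
  case 1
  show ?case by simp
next
  case (2 \<phi> s w)
  then show ?case
    using length_removeAll_less[of 1 "s # w"] by simp
next
  case (3 \<phi> s w)
  then show ?case by simp
next
  case (4 \<phi> s w v)
  have "length v \<le> length (s # w)"
    using N_map_length_partial[OF 4(4)] 4(2) by simp
  moreover have "length (removeAll 1 v) < length v"
    using 4(3) by (rule length_removeAll_less)
  moreover have "removeAll 1 (s # w) = s # w"
    using 4(1) by (rule removeAll_id)
  ultimately show ?case by simp
qed

declare N_map.simps [simp del]

definition N'_map :: "('a::one \<times> 'a \<Rightarrow> 'a \<times> 'a) \<Rightarrow> 'a list \<Rightarrow> 'a list" where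
  "N'_map \<phi> w = N_map \<phi> w @ replicate (length w - length (N_map \<phi> w)) 1"


subsection \<open>Normalisations\<close>

definition normalisation :: "'a set \<Rightarrow> ('a list \<Rightarrow> 'a list) \<Rightarrow> bool" where
  "normalisation A N \<longleftrightarrow>
     (\<forall>w\<in>lists A. N w \<in> lists A \<and> length (N w) = length w) \<and>
     (\<forall>a\<in>A. N [a] = [a]) \<and>
     (\<forall>u\<in>lists A. \<forall>v\<in>lists A. \<forall>w\<in>lists A. N (u @ v @ w) = N (u @ N v @ w))"

definition normal_word :: "('a list \<Rightarrow> 'a list) \<Rightarrow> 'a list \<Rightarrow> bool" where
  "normal_word N w \<longleftrightarrow> N w = w"

text \<open>Length-two words are read as pairs.\<close>

definition N_bar :: "('a list \<Rightarrow> 'a list) \<Rightarrow> 'a \<times> 'a \<Rightarrow> 'a \<times> 'a" where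
  "N_bar N = (\<lambda>(a, b). (N [a, b] ! 0, N [a, b] ! 1))"

definition quadratic_normalisation :: "'a set \<Rightarrow> ('a list \<Rightarrow> 'a list) \<Rightarrow> bool" where
  "quadratic_normalisation A N \<longleftrightarrow>
     normalisation A N \<and>
     (\<forall>w\<in>lists A. normal_word N w \<longleftrightarrow>
        (\<forall>u a b v. w = u @ [a, b] @ v \<longrightarrow> normal_word N [a, b])) \<and>
     (\<forall>w\<in>lists A. \<exists>is. set is \<subseteq> {1..<length w} \<and> N w = app_seq (N_bar N) is w)"

definition left_class :: "'a set \<Rightarrow> ('a list \<Rightarrow> 'a list) \<Rightarrow> nat \<Rightarrow> bool" where
  "left_class A N m \<longleftrightarrow>
     (\<forall>w\<in>lists A. length w = 3 \<longrightarrow>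
        N w = app_seq (N_bar N) (map (\<lambda>k. if even k then 1 else 2) [0..<m]) w)"

definition right_class :: "'a set \<Rightarrow> ('a list \<Rightarrow> 'a list) \<Rightarrow> nat \<Rightarrow> bool" where
  "right_class A N n \<longleftrightarrow>
     (\<forall>w\<in>lists A. length w = 3 \<longrightarrow>
        N w = app_seq (N_bar N) (map (\<lambda>k. if even k then 2 else 1) [0..<n]) w)"

definition quadratic_normalisation_of_class ::
  "'a set \<Rightarrow> ('a list \<Rightarrow> 'a list) \<Rightarrow> nat \<times> nat \<Rightarrow> bool" where
  "quadratic_normalisation_of_class A N = (\<lambda>(m, n).
     quadratic_normalisation A N \<and> left_class A N m \<and> right_class A N n)"

definition neutral :: "'a set \<Rightarrow> ('a list \<Rightarrow> 'a list) \<Rightarrow> 'a \<Rightarrow> bool" where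
  "neutral A N e \<longleftrightarrow>
     e \<in> A \<and> (\<forall>w\<in>lists A. N (w @ [e]) = N w @ [e] \<and> N ([e] @ w) = N w @ [e])"


subsection \<open>Monoid presentations\<close>

inductive_set generated_congruence ::
  "'a set \<Rightarrow> ('a list \<times> 'a list) set \<Rightarrow> ('a list \<times> 'a list) set"
  for A :: "'a set" and R :: "('a list \<times> 'a list) set" where
  base: "(u, v) \<in> R \<Longrightarrow> u \<in> lists A \<Longrightarrow> v \<in> lists A \<Longrightarrow> (u, v) \<in> generated_congruence A R"
| refl: "u \<in> lists A \<Longrightarrow> (u, u) \<in> generated_congruence A R"
| sym: "(u, v) \<in> generated_congruence A R \<Longrightarrow> (v, u) \<in> generated_congruence A R"
| trans: "(u, v) \<in> generated_congruence A R \<Longrightarrow> (v, w) \<in> generated_congruence A R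
    \<Longrightarrow> (u, w) \<in> generated_congruence A R"
| cong: "(u, v) \<in> generated_congruence A R \<Longrightarrow> (u', v') \<in> generated_congruence A R
    \<Longrightarrow> (u @ u', v @ v') \<in> generated_congruence A R"

text \<open>
  The monoid is presented by \<open>\<langle>S | R\<rangle>\<close> via the inclusion of \<open>S\<close>: some monoid isomorphism from
  the quotient of the free monoid over \<open>S\<close> by the congruence generated by \<open>R\<close> sends
  the class of each letter \<open>s\<close> to \<open>s\<close>.
\<close>

definition presented_by :: "'a::monoid_mult set \<Rightarrow> ('a list \<times> 'a list) set \<Rightarrow> bool" where
  "presented_by S R \<longleftrightarrow>
     (let cls = (\<lambda>w. generated_congruence S R `` {w}) in
      \<exists>h. bij_betw h (lists S // generated_congruence S R) (UNIV :: 'a set) \<and>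
          h (cls []) = 1 \<and>
          (\<forall>u\<in>lists S. \<forall>v\<in>lists S. h (cls (u @ v)) = h (cls u) * h (cls v)) \<and>
          (\<forall>s\<in>S. h (cls [s]) = s))"

definition normalisation_mod_1 :: "'a::monoid_mult set \<Rightarrow> ('a list \<Rightarrow> 'a list) \<Rightarrow> bool" where
  "normalisation_mod_1 S N \<longleftrightarrow>
     normalisation S N \<and> neutral S N 1 \<and>
     presented_by S ({(w, N w) | w. w \<in> lists S} \<union> {([1], [])})"

end

theory Submission
  imports Defs
begin

text \<open>
  Call a word stable if \<open>\<phi>\<close> fixes each of its adjacent pairs. The factorability condition on the
  triple \<open>(1, s, f)\<close> shows that a stable word without the letter \<open>1\<close> is obtained by iterating
  \<open>\<eta>\<close> on its product, so a stable word is determined by its length and its product. The same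
  condition shows that \<open>N_map \<phi>\<close> produces stable words; hence \<open>N'_map \<phi> w\<close> is the only stable word
  with the length and the product of \<open>w\<close>, and every required identity between words reduces to an
  identity in the monoid. The hypothesis on \<open>\<phi>\<close> enters only for the class, where it makes
  \<open>\<phi>\<^sub>2\<phi>\<^sub>1\<phi>\<^sub>2\<close> take stable values.
\<close>

section \<open>Computation rules for local maps, sweeps and the recursion\<close>

lemma app_at_append:
  "app_at F (Suc (length u)) (u @ a # b # v) = u @ fst (F (a, b)) # snd (F (a, b)) # v"
  by (simp add: app_at_def nth_append list_update_append split: prod.split)

lemma app_at_1: "app_at F (Suc 0) (a # b # v) = fst (F (a, b)) # snd (F (a, b)) # v"
  using app_at_append[of F "[]" a b v] by simp

lemma app_at_2: "app_at F 2 (x # a # b # v) = x # fst (F (a, b)) # snd (F (a, b)) # v"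
  using app_at_append[of F "[x]" a b v] by (simp add: numeral_2_eq_2)

lemma app_at_Suc_Cons: "0 < i \<Longrightarrow> app_at F (Suc i) (a # w) = a # app_at F i w"
  by (cases i) (auto simp: app_at_def split: prod.split)

lemma app_seq_Suc_Cons:
  "0 \<notin> set is \<Longrightarrow> app_seq F (map Suc is) (a # w) = a # app_seq F is w"
  unfolding app_seq_def by (induction "is" arbitrary: w) (auto simp: app_at_Suc_Cons)

lemma T_map_single [simp]: "T_map F [s] = [s]"
  by (simp add: T_map_def app_seq_def)

lemma T_map_Cons2:
  "T_map F (s # a # w) = fst (F (s, a)) # T_map F (snd (F (s, a)) # w)"
proof -
  have "[1..<length (s # a # w)] = 1 # map Suc [1..<length (a # w)]"
    by (simp add: map_Suc_upt upt_conv_Cons del: upt_Suc)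
  then have "T_map F (s # a # w) =
      app_seq F (map Suc [1..<length (a # w)]) (fst (F (s, a)) # snd (F (s, a)) # w)"
    unfolding T_map_def by (simp add: app_seq_def app_at_1 del: upt_Suc)
  also have "\<dots> = fst (F (s, a)) # T_map F (snd (F (s, a)) # w)"
    by (subst app_seq_Suc_Cons) (auto simp: T_map_def)
  finally show ?thesis .
qed

lemma N_map_removeAll: "1 \<in> set w \<Longrightarrow> N_map F w = N_map F (removeAll 1 w)"
  by (cases w) (simp, simp only: N_map.simps(2) if_True)

lemma N_map_Cons:
  assumes "1 \<notin> set (s # w)" and "v = T_map F (s # N_map F w)"
  shows "N_map F (s # w) = (if 1 \<in> set v then N_map F v else v)"
  using assms by (simp only: N_map.simps(2) if_False Let_def)

text \<open>The induction rule of the recursion, recast with the map \<open>F\<close> held fixed and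
  the removal case stated for any word containing \<open>1\<close>, so that the nested conditional
  is taken apart only once.\<close>

lemma N_map_induct [case_names Nil one Cons]:
  assumes "P []"
    and one: "\<And>w. 1 \<in> set w \<Longrightarrow> P (removeAll 1 w) \<Longrightarrow> P w"
    and Cons: "\<And>s w v. 1 \<notin> set (s # w) \<Longrightarrow> v = T_map F (s # N_map F w) \<Longrightarrow> P w \<Longrightarrow>
      (1 \<in> set v \<Longrightarrow> P v) \<Longrightarrow> P (s # w)"
  shows "P w"
proof -
  \<comment> \<open>The generated rule varies the map argument too; the guard \<open>F' = F\<close>
    pins it down.\<close>
  have "F' = F \<longrightarrow> P w" for F'
  proof (induction F' w rule: N_map.induct)
    case (2 F' s w)
    show ?case
    proof (cases "1 \<in> set (s # w)")
      case True
      then show ?thesis using one 2(1) by blast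
    next
      case False
      then show ?thesis using Cons[OF False HOL.refl] 2(2)[OF False] 2(3)[OF False HOL.refl] by blast
    qed
  qed (use assms(1) in simp)
  then show ?thesis by blast
qed

lemma length_N_map: "length (N_map F w) \<le> length w"
proof (induction w rule: N_map_induct[where F = F])
  case Nil
  then show ?case by (simp add: N_map.simps)
next
  case (one w)
  then show ?case
    using le_trans[OF _ length_removeAll_less_eq] by (simp add: N_map_removeAll[OF one(1)])
next
  case (Cons s w v)
  then have "length v \<le> length (s # w)" by simp
  with Cons(4) show ?case by (auto simp: N_map_Cons[OF Cons(1,2)])
qed

section \<open>Rewriting by single applications of a pair map\<close>

text \<open>The position is hidden in the context \<open>u\<close>, \<open>v\<close>, which makes
  closure under contexts immediate; numbered positions are recovered in
  \<open>rewrite_steps_app_seq\<close>.\<close>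

inductive rewrite_step :: "('a \<times> 'a \<Rightarrow> 'a \<times> 'a) \<Rightarrow> 'a list \<Rightarrow> 'a list \<Rightarrow> bool" for F where
  "rewrite_step F (u @ a # b # v) (u @ fst (F (a, b)) # snd (F (a, b)) # v)"

lemma rewrite_step_context:
  assumes "rewrite_step F w w'"
  shows "rewrite_step F (x @ w @ y) (x @ w' @ y)"
  using assms
proof cases
  case (1 u a b v)
  then show ?thesis using rewrite_step.intros[of F "x @ u" a b "v @ y"] by simp
qed

lemma rewrite_steps_context:
  "(rewrite_step F)\<^sup>*\<^sup>* w w' \<Longrightarrow> (rewrite_step F)\<^sup>*\<^sup>* (x @ w @ y) (x @ w' @ y)"
  by (induction rule: rtranclp_induct) (auto intro: rewrite_step_context rtranclp.rtrancl_into_rtrancl)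

lemma rewrite_steps_T_map: "(rewrite_step F)\<^sup>*\<^sup>* (s # w) (T_map F (s # w))"
proof (induction w arbitrary: s)
  case (Cons a w)
  have "rewrite_step F (s # a # w) (fst (F (s, a)) # snd (F (s, a)) # w)"
    using rewrite_step.intros[of F "[]"] by simp
  also have "(rewrite_step F)\<^sup>*\<^sup>* \<dots> (fst (F (s, a)) # T_map F (snd (F (s, a)) # w))"
    using rewrite_steps_context[OF Cons.IH, of "[fst (F (s, a))]" _ "[]"] by simp
  finally show ?case by (simp add: T_map_Cons2)
qed simp

section \<open>Adjacent pairs, and a criterion for presentations\<close>

lemma successively_iff_factors:
  "successively P w \<longleftrightarrow> (\<forall>u a b v. w = u @ [a, b] @ v \<longrightarrow> P a b)"
proof
  assume "successively P w"
  then show "\<forall>u a b v. w = u @ [a, b] @ v \<longrightarrow> P a b"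
    by (auto simp: successively_append_iff)
next
  assume "\<forall>u a b v. w = u @ [a, b] @ v \<longrightarrow> P a b"
  then show "successively P w"
  proof (induction P w rule: successively.induct)
    case (3 P x y xs)
    have "P x y" using 3(2) by (metis append_Cons append_Nil)
    moreover have "successively P (y # xs)"
      using 3(2) by (intro 3(1)) (metis append_Cons)
    ultimately show ?case by simp
  qed simp_all
qed

text \<open>The isomorphism is evaluation on congruence classes: \<open>sound\<close> makes it well
  defined, \<open>complete\<close> injective, and \<open>gen\<close> surjective.\<close>

lemma presented_byI:
  fixes S :: "'a::monoid_mult set"
  assumes gen: "generates S"
    and sound: "\<And>u v. (u, v) \<in> R \<Longrightarrow> prod_list u = prod_list v"
    and complete: "\<And>u v. u \<in> lists S \<Longrightarrow> v \<in> lists S \<Longrightarrow> prod_list u = prod_list v \<Longrightarrow>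
      (u, v) \<in> generated_congruence S R"
  shows "presented_by S R"
proof -
  define C where "C = generated_congruence S R"
  \<comment> \<open>A class is evaluated at an arbitrary representative; \<open>h_cls\<close> shows
    that the choice is immaterial.\<close>
  define h where "h X = prod_list (SOME w. w \<in> X)" for X :: "'a list set"
  have prod_eq: "prod_list u = prod_list v \<and> u \<in> lists S \<and> v \<in> lists S" if "(u, v) \<in> C" for u v
    using that unfolding C_def by induction (auto dest: sound)
  have h_cls: "h (C `` {w}) = prod_list w" if "w \<in> lists S" for w
  proof -
    have "w \<in> C `` {w}" using that by (auto simp: C_def intro: generated_congruence.refl)
    then have "(SOME w'. w' \<in> C `` {w}) \<in> C `` {w}" by (rule someI)
    then show ?thesis unfolding h_def using prod_eq by auto
  qed
  have cls_eq: "C `` {u} = C `` {v}"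
    if "u \<in> lists S" "v \<in> lists S" "prod_list u = prod_list v" for u v
  proof -
    have "(u, v) \<in> C" using complete that by (simp add: C_def)
    then show ?thesis
      unfolding C_def by (auto intro: generated_congruence.trans generated_congruence.sym)
  qed
  have "bij_betw h (lists S // C) UNIV"
  proof (rule bij_betwI')
    fix X Y assume "X \<in> lists S // C" "Y \<in> lists S // C"
    then obtain u v where "u \<in> lists S" "X = C `` {u}" "v \<in> lists S" "Y = C `` {v}"
      by (metis quotientE)
    then show "(h X = h Y) = (X = Y)" using h_cls cls_eq by metis
  next
    fix f :: 'a
    obtain w where "w \<in> lists S" "prod_list w = f"
      using gen unfolding generates_def by blast
    then show "\<exists>X \<in> lists S // C. f = h X"
      using h_cls by (metis quotientI)
  qed simp
  moreover have "h (C `` {u @ v}) = h (C `` {u}) * h (C `` {v})"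
    if "u \<in> lists S" "v \<in> lists S" for u v
    using that h_cls by (simp)
  moreover have "h (C `` {[]}) = 1" "\<And>s. s \<in> S \<Longrightarrow> h (C `` {[s]}) = s"
    using h_cls[of "[]"] h_cls[of "[_]"] by auto
  ultimately show ?thesis
    unfolding presented_by_def Let_def C_def by blast
qed

section \<open>Word length and factorisation in a factorable monoid\<close>

locale factorable =
  fixes S :: "'a::monoid_mult set"
    and \<eta> :: "'a \<Rightarrow> 'a \<times> 'a"
    and \<phi> :: "'a \<times> 'a \<Rightarrow> 'a \<times> 'a"
  assumes factorable: "factorable_monoid S \<eta>"
    and phi_eq: "\<phi> = restrict (\<eta> \<circ> mult_pair) (S \<times> S)"
begin

lemma one_mem: "1 \<in> S"
  and generates: "generates S"
  and factorability: "factorability_structure S \<eta>"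
  using factorable by (auto simp: factorable_monoid_def)

lemma eta_one [simp]: "\<eta> 1 = (1, 1)"
  using factorability by (auto simp: factorability_structure_def factorisation_map_def)

lemma wlen_le: "w \<in> lists S \<Longrightarrow> prod_list w = f \<Longrightarrow> wlen S f \<le> length w"
  unfolding wlen_def by (rule Least_le) blast

lemma wlen_word: obtains w where "w \<in> lists S" "length w = wlen S f" "prod_list w = f"
proof -
  have "\<exists>w\<in>lists S. prod_list w = f"
    using generates unfolding generates_def ..
  then have "\<exists>n. \<exists>w\<in>lists S. length w = n \<and> prod_list w = f" by blast
  then have "\<exists>w\<in>lists S. length w = wlen S f \<and> prod_list w = f"
    unfolding wlen_def by (rule LeastI_ex)
  then show thesis using that by blast
qed

lemma wlen_eq_0: "wlen S f = 0 \<longleftrightarrow> f = 1"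
proof
  assume "wlen S f = 0"
  moreover obtain w where "length w = wlen S f" "prod_list w = f" by (rule wlen_word)
  ultimately show "f = 1" by simp
next
  assume "f = 1"
  then show "wlen S f = 0" using wlen_le[of "[]" f] by simp
qed

lemma wlen_one [simp]: "wlen S 1 = 0"
  by (simp add: wlen_eq_0)

lemma wlen_letter: "s \<in> S - {1} \<Longrightarrow> wlen S s = 1"
  using wlen_le[of "[s]" s] wlen_eq_0[of s] by (cases "wlen S s") auto

lemma wlen_letter_le: "s \<in> S \<Longrightarrow> wlen S s \<le> 1"
  using wlen_le[of "[s]" s] by simp

lemma mem_if_wlen_le_1: "wlen S f \<le> 1 \<Longrightarrow> f \<in> S"
proof -
  assume "wlen S f \<le> 1"
  moreover obtain w where "w \<in> lists S" "length w = wlen S f" "prod_list w = f"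
    by (rule wlen_word)
  ultimately show "f \<in> S" using one_mem
    by (cases w; cases "tl w") auto
qed

lemma eta:
  assumes "\<eta> f = (a, g)"
  shows "a * g = f" "wlen S f = wlen S a + wlen S g" "a \<in> S" "f \<noteq> 1 \<Longrightarrow> a \<noteq> 1"
proof -
  have "a * g = f \<and> wlen S f = wlen S a + wlen S g \<and> a \<in> S \<and> (f \<noteq> 1 \<longrightarrow> a \<noteq> 1)"
  proof (cases "f = 1")
    case True
    then show ?thesis using assms one_mem by simp
  next
    case False
    have "factorisation_map S \<eta>" using factorability by (simp add: factorability_structure_def)
    then have "fst (\<eta> f) \<in> S - {1} \<and> fst (\<eta> f) * snd (\<eta> f) = f \<and>
        wlen S f = wlen S (fst (\<eta> f)) + wlen S (snd (\<eta> f))"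
      using False unfolding factorisation_map_def by blast
    then show ?thesis using assms by simp
  qed
  then show "a * g = f" "wlen S f = wlen S a + wlen S g" "a \<in> S" "f \<noteq> 1 \<Longrightarrow> a \<noteq> 1"
    by blast+
qed

text \<open>For a nontrivial letter the left factor already uses up the length 1, so the cofactor
  has length 0 and equals \<open>1\<close>.\<close>

lemma eta_letter: "s \<in> S \<Longrightarrow> \<eta> s = (s, 1)"
proof (cases "s = 1")
  case False
  assume s: "s \<in> S"
  obtain a g where ag: "\<eta> s = (a, g)" by fastforce
  have "a \<in> S - {1}" using eta[OF ag] False by auto
  then have "wlen S g = 0"
    using eta(2)[OF ag] wlen_letter[of a] wlen_letter_le[OF s] by simp
  then have "g = 1" by (simp add: wlen_eq_0)
  then show ?thesis using ag eta(1)[OF ag] by simp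
qed simp

section \<open>The factorability condition at triples beginning with 1\<close>

lemma factorability_cases:
  assumes "length x = 3" and "F1 = app_at (\<eta> \<circ> mult_pair) 1" and "F2 = app_at (\<eta> \<circ> mult_pair) 2"
  obtains "F1 (F2 (F1 (F2 x))) = F2 (F1 (F2 x))" "F2 (F1 (F2 x)) = F2 (F1 (F2 (F1 x)))"
  | "total_wlen S (F2 (F1 (F2 x))) < total_wlen S x"
    "total_wlen S (F2 (F1 (F2 (F1 x)))) < total_wlen S x"
  using factorability assms unfolding factorability_structure_def Let_def by metis

text \<open>Both sides of the condition are evaluated at \<open>[1, s, f]\<close>. Since
  \<open>\<eta> s = (s, 1)\<close>, applying \<open>F1\<close>, \<open>F2\<close>,
  \<open>F1\<close>, \<open>F2\<close> in turn gives \<open>[b, d, h]\<close>, whereas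
  \<open>F2\<close>, \<open>F1\<close>, \<open>F2\<close> factorise \<open>s * f\<close> as
  \<open>(p, q)\<close> and end in \<open>[p, p', q']\<close> with \<open>p' * q' = q\<close>. The
  assumption \<open>len\<close> forbids a loss of length, so the two values agree and
  \<open>F1\<close> fixes them.\<close>

lemma eta_letter_mult:
  assumes s: "s \<in> S" and f: "\<eta> f = (a, g)" and sa: "\<eta> (s * a) = (b, c)"
    and cg: "\<eta> (c * g) = (d, h)"
    and len: "wlen S s + wlen S f \<le> wlen S b + wlen S (c * g)"
  shows "\<eta> (b * d) = (b, d)" "\<eta> (s * f) = (b, c * g)"
proof -
  define F1 where "F1 = app_at (\<eta> \<circ> mult_pair) 1"
  define F2 where "F2 = app_at (\<eta> \<circ> mult_pair) 2"
  obtain p q where pq: "\<eta> (s * f) = (p, q)" by fastforce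
  obtain p' q' where pq': "\<eta> q = (p', q')" by fastforce
  have 1: "F2 (F1 (F2 [1, s, f])) = [p, p', q']"
    by (simp add: F1_def F2_def app_at_1 app_at_2 mult_pair_def pq pq' eta_letter[OF eta(3)[OF pq]])
  have 2: "F2 (F1 (F2 (F1 [1, s, f]))) = [b, d, h]"
    by (simp add: F1_def F2_def app_at_1 app_at_2 mult_pair_def eta_letter[OF s] f sa cg)
  \<comment> \<open>By \<open>eta(2)\<close> the lengths of \<open>d\<close> and \<open>h\<close>
    add up to that of \<open>c * g\<close>, and the leading \<open>1\<close> contributes 0.\<close>
  have "\<not> total_wlen S [b, d, h] < total_wlen S [1, s, f]"
    using len eta(2)[OF cg] by (simp add: total_wlen_def)
  then have 3: "F1 [b, d, h] = [b, d, h]" and 4: "[p, p', q'] = [b, d, h]"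
    using factorability_cases[OF _ F1_def F2_def, of "[1, s, f]"] 1 2 by auto
  show "\<eta> (b * d) = (b, d)"
    using 3 by (simp add: F1_def app_at_1 mult_pair_def prod_eq_iff)
  have "q = c * g" using eta(1)[OF pq'] eta(1)[OF cg] 4 by simp
  then show "\<eta> (s * f) = (b, c * g)" using pq 4 by simp
qed

section \<open>The pair map on generators\<close>

lemma phi_eta: "s \<in> S \<Longrightarrow> t \<in> S \<Longrightarrow> \<phi> (s, t) = \<eta> (s * t)"
  by (simp add: phi_eq mult_pair_def)

text \<open>The left factor of a nontrivial product has length 1 and a product of two letters has
  length at most 2, so the right factor is again in \<open>S\<close>. Idempotence holds because
  \<phi> depends only on the product of the pair, which it preserves.\<close>

lemma phi:
  assumes "s \<in> S" "t \<in> S" "\<phi> (s, t) = (a, b)"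
  shows "a \<in> S" "b \<in> S" "a * b = s * t" "\<phi> (a, b) = (a, b)"
proof -
  have st: "\<eta> (s * t) = (a, b)" using assms by (simp add: phi_eta)
  show a: "a \<in> S" and ab: "a * b = s * t" using eta[OF st] by auto
  show b: "b \<in> S"
  proof (cases "s * t = 1")
    case True
    then show ?thesis using st one_mem by simp
  next
    case False
    then have "wlen S a = 1" using eta[OF st] by (intro wlen_letter) auto
    moreover have "wlen S (s * t) \<le> 2" using wlen_le[of "[s, t]" "s * t"] assms by simp
    ultimately show ?thesis using eta(2)[OF st] by (intro mem_if_wlen_le_1) simp
  qed
  show "\<phi> (a, b) = (a, b)" using a b ab st by (simp add: phi_eta)
qed

lemma phi_mem: "s \<in> S \<Longrightarrow> t \<in> S \<Longrightarrow> fst (\<phi> (s, t)) \<in> S \<and> snd (\<phi> (s, t)) \<in> S"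
  using phi(1,2)[of s t "fst (\<phi> (s, t))" "snd (\<phi> (s, t))"] by simp

lemma phi_mult: "s \<in> S \<Longrightarrow> t \<in> S \<Longrightarrow> fst (\<phi> (s, t)) * snd (\<phi> (s, t)) = s * t"
  using phi(3)[of s t "fst (\<phi> (s, t))" "snd (\<phi> (s, t))"] by simp

lemma phi_idem: "s \<in> S \<Longrightarrow> t \<in> S \<Longrightarrow> \<phi> (fst (\<phi> (s, t)), snd (\<phi> (s, t))) = \<phi> (s, t)"
  using phi(4)[of s t "fst (\<phi> (s, t))" "snd (\<phi> (s, t))"] by simp

lemma phi_one: "s \<in> S \<Longrightarrow> \<phi> (1, s) = (s, 1)" "s \<in> S \<Longrightarrow> \<phi> (s, 1) = (s, 1)"
  using one_mem by (simp_all add: phi_eta eta_letter)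

section \<open>Stable words are determined by their products\<close>

definition stable :: "'a list \<Rightarrow> bool" where
  "stable w \<longleftrightarrow> w \<in> lists S \<and> successively (\<lambda>a b. \<phi> (a, b) = (a, b)) w"

lemma stable_Nil [simp]: "stable []"
  by (simp add: stable_def)

lemma stable_Cons:
  "stable (s # w) \<longleftrightarrow> s \<in> S \<and> stable w \<and> (w = [] \<or> \<phi> (s, hd w) = (s, hd w))"
  by (cases w) (auto simp: stable_def)

lemma stable_mem: "stable w \<Longrightarrow> w \<in> lists S"
  by (simp add: stable_def)

text \<open>Induction on the tail, whose product is \<open>f\<close>. The pair \<open>(s, a)\<close>
  is fixed, so \<open>eta_letter_mult\<close> applies with \<open>b = s\<close>,
  \<open>c = a\<close> and \<open>c * g = f\<close>, its length assumption being an equality. Local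
  stability thus controls the factorisation of the whole product, and the word is a shortest
  one.\<close>

lemma stable_eta:
  assumes "stable (s # w)" "1 \<notin> set (s # w)"
  shows "\<eta> (prod_list (s # w)) = (s, prod_list w) \<and> wlen S (prod_list (s # w)) = Suc (length w)"
  using assms
proof (induction w arbitrary: s)
  case Nil
  then show ?case by (simp add: stable_Cons eta_letter wlen_letter)
next
  case (Cons a w)
  define f where "f = prod_list (a # w)"
  have s: "s \<in> S" "s \<noteq> 1" and a: "a \<in> S" "\<phi> (s, a) = (s, a)"
    and st: "stable (a # w)" "1 \<notin> set (a # w)"
    using Cons.prems by (auto simp: stable_Cons)
  have f: "\<eta> f = (a, prod_list w)" and len: "wlen S f = Suc (length w)"
    using Cons.IH[OF st] by (auto simp: f_def)
  have "\<eta> (s * a) = (s, a)" using s a by (simp add: phi_eta)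
  from eta_letter_mult(2)[OF s(1) f this]
  have "\<eta> (s * f) = (s, f)" using f by (simp add: f_def)
  then show ?case
    using eta(2)[of "s * f" s f] s len by (simp add: f_def wlen_letter)
qed

text \<open>By \<open>stable_eta\<close>, \<eta> reads off the first letter and the product of the
  rest, so the words can be compared letter by letter; a nonempty word of this kind has positive
  length, hence a product other than \<open>1\<close>.\<close>

lemma stable_unique:
  assumes "stable u" "1 \<notin> set u" "stable v" "1 \<notin> set v" "prod_list u = prod_list v"
  shows "u = v"
  using assms
proof (induction u arbitrary: v)
  case Nil
  then show ?case using stable_eta[of "hd v" "tl v"] by (cases v) auto
next
  case (Cons s u)
  have s: "\<eta> (prod_list (s # u)) = (s, prod_list u)" "wlen S (prod_list (s # u)) \<noteq> 0"
    using stable_eta[OF Cons.prems(1,2)] by auto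
  with Cons.prems(5) obtain t v' where v: "v = t # v'" by (cases v) auto
  have "\<eta> (prod_list v) = (t, prod_list v')"
    using stable_eta[of t v'] Cons.prems v by auto
  then have "s = t" "prod_list u = prod_list v'" using s Cons.prems(5) by auto
  moreover have "u = v'"
    using Cons.IH[of v'] Cons.prems v calculation by (auto simp: stable_Cons)
  ultimately show ?case using v by simp
qed

section \<open>Sweeps and the recursive map\<close>

lemma T_map_props:
  "s \<in> S \<Longrightarrow> w \<in> lists S \<Longrightarrow>
    T_map \<phi> (s # w) \<in> lists S \<and> prod_list (T_map \<phi> (s # w)) = s * prod_list w"
proof (induction w arbitrary: s)
  case (Cons a w)
  have "fst (\<phi> (s, a)) \<in> S" "snd (\<phi> (s, a)) \<in> S" "fst (\<phi> (s, a)) * snd (\<phi> (s, a)) = s * a"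
    using Cons.prems phi_mem phi_mult by auto
  then show ?case
    using Cons.IH[of "snd (\<phi> (s, a))"] Cons.prems
    by (auto simp: T_map_Cons2 mult.assoc[symmetric])
qed simp

text \<open>The induction covers the pairs inside the swept tail; only the junction
  \<open>(b, d)\<close> is new. Absence of \<open>1\<close> from the result means that no length is
  lost, which is what \<open>eta_letter_mult\<close> asks for.\<close>

lemma stable_T_map:
  assumes "s \<in> S" "stable w" "1 \<notin> set w" "1 \<notin> set (T_map \<phi> (s # w))"
  shows "stable (T_map \<phi> (s # w))"
  using assms
proof (induction w arbitrary: s)
  case (Cons a w)
  define f where "f = prod_list (a # w)"
  obtain b c where bc: "\<phi> (s, a) = (b, c)" by fastforce
  define v where "v = T_map \<phi> (c # w)"
  have a: "a \<in> S" and w: "stable w" "1 \<notin> set w" "w \<in> lists S"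
    using Cons.prems by (auto simp: stable_Cons dest: stable_mem)
  have b: "b \<in> S" "c \<in> S" using phi[OF _ _ bc] a Cons.prems by auto
  have T: "T_map \<phi> (s # a # w) = b # v" by (simp add: T_map_Cons2 bc v_def)
  have "1 \<notin> set v" "b \<noteq> 1" using Cons.prems T by auto
  have v: "stable v" using Cons.IH[of c] w b \<open>1 \<notin> set v\<close> by (simp add: v_def)
  have "length v = Suc (length w)" by (simp add: v_def)
  then obtain d v' where v': "v = d # v'" by (cases v) auto
  have pv: "prod_list v = c * prod_list w" using T_map_props[of c w] b w by (simp add: v_def)
  have vd: "\<eta> (c * prod_list w) = (d, prod_list v')"
    and lv: "wlen S (c * prod_list w) = Suc (length w)"
    using stable_eta[of d v'] v \<open>1 \<notin> set v\<close> v' pv \<open>length v = Suc (length w)\<close> by auto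
  have f: "\<eta> f = (a, prod_list w)" and lf: "wlen S f = Suc (length w)"
    using stable_eta[of a w] Cons.prems by (auto simp: f_def)
  have "\<eta> (s * a) = (b, c)" using bc a Cons.prems by (simp add: phi_eta)
  \<comment> \<open>Lengths: \<open>f\<close> and \<open>c * prod_list w\<close> both have
    \<open>Suc (length w)\<close>, \<open>b\<close> has exactly 1, and \<open>s\<close> at most
    1.\<close>
  from eta_letter_mult(1)[OF _ f this vd]
  have "\<eta> (b * d) = (b, d)"
    using lv lf wlen_letter[of b] wlen_letter_le[of s] b \<open>b \<noteq> 1\<close> Cons.prems by simp
  moreover have "d \<in> S" using v v' by (simp add: stable_Cons)
  ultimately have "\<phi> (b, d) = (b, d)" using b by (simp add: phi_eta)
  then show ?case using v v' b by (simp add: T stable_Cons)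
qed (simp add: stable_Cons)

lemma prod_list_removeAll_one: "prod_list (removeAll 1 w) = prod_list w"
  by (induction w) auto

text \<open>If a sweep creates a \<open>1\<close>, stability comes from the recursive call,
  otherwise from \<open>stable_T_map\<close>. Deleting \<open>1\<close> and sweeping both keep the
  product.\<close>

lemma N_map_props:
  "w \<in> lists S \<Longrightarrow>
    stable (N_map \<phi> w) \<and> 1 \<notin> set (N_map \<phi> w) \<and> prod_list (N_map \<phi> w) = prod_list w"
proof (induction w rule: N_map_induct[where F = \<phi>])
  case Nil
  then show ?case by (simp add: N_map.simps)
next
  case (one w)
  have "removeAll 1 w \<in> lists S" using one.prems by auto
  from one.IH[OF this] show ?case
    unfolding N_map_removeAll[OF one.hyps] prod_list_removeAll_one .
next
  case (Cons s w v)
  have s: "s \<in> S" and w: "w \<in> lists S" using Cons.prems by auto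
  have IH: "stable (N_map \<phi> w)" "1 \<notin> set (N_map \<phi> w)" "prod_list (N_map \<phi> w) = prod_list w"
    using Cons.IH(1)[OF w] by auto
  have v: "v \<in> lists S" "prod_list v = prod_list (s # w)"
    using T_map_props[OF s stable_mem[OF IH(1)]] IH(3) by (simp_all add: Cons.hyps(2))
  show ?case
  proof (cases "1 \<in> set v")
    case True
    then show ?thesis using Cons.IH(2)[OF True v(1)] v(2) N_map_Cons[OF Cons.hyps] by simp
  next
    case False
    then show ?thesis
      using stable_T_map[OF s IH(1,2)] v N_map_Cons[OF Cons.hyps] by (simp add: Cons.hyps(2))
  qed
qed

section \<open>Reaching the recursive map by local steps\<close>

lemma rewrite_steps_one_Cons:
  "w \<in> lists S \<Longrightarrow> (rewrite_step \<phi>)\<^sup>*\<^sup>* (1 # w) (w @ [1])"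
proof (induction w)
  case (Cons a w)
  have "rewrite_step \<phi> (1 # a # w) (a # 1 # w)"
    using rewrite_step.intros[of \<phi> "[]" 1 a w] Cons.prems by (simp add: phi_one)
  also have "(rewrite_step \<phi>)\<^sup>*\<^sup>* (a # 1 # w) (a # w @ [1])"
    using rewrite_steps_context[OF Cons.IH, of "[a]" "[]"] Cons.prems by simp
  finally show ?case by simp
qed simp

lemma rewrite_steps_removeAll_one:
  "w \<in> lists S \<Longrightarrow> \<exists>m. (rewrite_step \<phi>)\<^sup>*\<^sup>* w (removeAll 1 w @ replicate m 1)"
proof (induction w)
  case (Cons a w)
  then obtain m where m: "(rewrite_step \<phi>)\<^sup>*\<^sup>* w (removeAll 1 w @ replicate m 1)" by auto
  have 1: "(rewrite_step \<phi>)\<^sup>*\<^sup>* (a # w) (a # removeAll 1 w @ replicate m 1)"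
    using rewrite_steps_context[OF m, of "[a]" "[]"] by simp
  show ?case
  proof (cases "a = 1")
    case True
    have "removeAll 1 w @ replicate m 1 \<in> lists S" using Cons.prems one_mem by auto
    from rewrite_steps_one_Cons[OF this] 1 True
    have "(rewrite_step \<phi>)\<^sup>*\<^sup>* (a # w) (removeAll 1 w @ replicate m 1 @ [1])" by simp
    then show ?thesis using True by (intro exI[of _ "Suc m"]) (simp add: replicate_append_same)
  next
    case False
    then show ?thesis using 1 by auto
  qed
qed (intro exI[of _ 0], simp)

text \<open>Local steps preserve length, so deleted letters \<open>1\<close> are instead moved to
  the right end by \<open>\<phi> (1, s) = (s, 1)\<close>; the blocks collected at successive stages
  add up.\<close>

lemma rewrite_steps_N_map:
  "w \<in> lists S \<Longrightarrow> \<exists>m. (rewrite_step \<phi>)\<^sup>*\<^sup>* w (N_map \<phi> w @ replicate m 1)"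
proof (induction w rule: N_map_induct[where F = \<phi>])
  case Nil
  then show ?case by (intro exI[of _ 0]) (simp add: N_map.simps)
next
  case (one w)
  have "removeAll 1 w \<in> lists S" using one.prems by auto
  then obtain m where
    m: "(rewrite_step \<phi>)\<^sup>*\<^sup>* (removeAll 1 w) (N_map \<phi> w @ replicate m 1)"
    using one.IH N_map_removeAll[OF one.hyps] by metis
  obtain k where "(rewrite_step \<phi>)\<^sup>*\<^sup>* w (removeAll 1 w @ replicate k 1)"
    using rewrite_steps_removeAll_one[OF one.prems] by blast
  also have "(rewrite_step \<phi>)\<^sup>*\<^sup>* \<dots> (N_map \<phi> w @ replicate (m + k) 1)"
    using rewrite_steps_context[OF m, of "[]" "replicate k 1"] by (simp add: replicate_add)
  finally show ?case by blast
next
  case (Cons s w v)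
  have s: "s \<in> S" and w: "w \<in> lists S" using Cons.prems by auto
  have v: "v \<in> lists S"
    unfolding Cons.hyps(2) using T_map_props[OF s, of "N_map \<phi> w"] N_map_props[OF w] stable_mem
    by blast
  obtain m where m: "(rewrite_step \<phi>)\<^sup>*\<^sup>* w (N_map \<phi> w @ replicate m 1)"
    using Cons.IH(1)[OF w] by blast
  obtain k where k: "(rewrite_step \<phi>)\<^sup>*\<^sup>* v (N_map \<phi> (s # w) @ replicate k 1)"
  proof (cases "1 \<in> set v")
    case True
    then show ?thesis using Cons.IH(2)[OF True v] N_map_Cons[OF Cons.hyps] that by auto
  next
    case False
    then show ?thesis using N_map_Cons[OF Cons.hyps] that[of 0] by simp
  qed
  have "(rewrite_step \<phi>)\<^sup>*\<^sup>* (s # w) (s # N_map \<phi> w @ replicate m 1)"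
    using rewrite_steps_context[OF m, of "[s]" "[]"] by simp
  also have "(rewrite_step \<phi>)\<^sup>*\<^sup>* \<dots> (v @ replicate m 1)"
    using rewrite_steps_context[OF rewrite_steps_T_map, of \<phi> "[]" s "N_map \<phi> w" "replicate m 1"]
    by (simp add: Cons.hyps(2))
  also have "(rewrite_step \<phi>)\<^sup>*\<^sup>* \<dots> (N_map \<phi> (s # w) @ replicate (k + m) 1)"
    using rewrite_steps_context[OF k, of "[]" "replicate m 1"] by (simp add: replicate_add)
  finally show ?case by blast
qed

section \<open>The padded map and its characterisation\<close>

abbreviation N :: "'a list \<Rightarrow> 'a list" where
  "N \<equiv> N'_map \<phi>"

lemma stable_append_ones: "stable w \<Longrightarrow> stable (w @ replicate m 1)"
proof (induction w)
  case Nil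
  show ?case 
  proof (induction m)
    case (Suc m)
    then show ?case by (cases m) (auto simp: stable_Cons one_mem phi_one)
  qed simp
next
  case (Cons s w)
  then show ?case
    by (cases w; cases m) (auto simp: stable_Cons phi_one)
qed

lemma stable_split_ones:
  "stable w \<Longrightarrow> \<exists>u m. w = u @ replicate m 1 \<and> stable u \<and> 1 \<notin> set u"
proof (induction w)
  case (Cons s w)
  then obtain u m where u: "w = u @ replicate m 1" "stable u" "1 \<notin> set u"
    by (auto simp: stable_Cons)
  show ?case
  proof (cases "s = 1")
    case True
    \<comment> \<open>A first letter \<open>a\<close> of \<open>u\<close> would be nontrivial, but
      \<phi> sends \<open>(1, a)\<close> to \<open>(a, 1)\<close> and so does not fix it.\<close>
    have "u = []"
      using Cons.prems u True by (cases u) (auto simp: stable_Cons phi_one)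
    then show ?thesis using u True by (intro exI[of _ "[]"] exI[of _ "Suc m"]) simp
  next
    case False
    then have "stable (s # u)" using Cons.prems u by (cases u) (auto simp: stable_Cons)
    then show ?thesis using u False by (intro exI[of _ "s # u"] exI[of _ m]) simp
  qed
qed simp

lemma length_N [simp]: "length (N w) = length w"
  using length_N_map[of \<phi> w] by (simp add: N'_map_def)

lemma stable_N: "w \<in> lists S \<Longrightarrow> stable (N w)"
  and prod_list_N: "w \<in> lists S \<Longrightarrow> prod_list (N w) = prod_list w"
  by (simp_all add: N'_map_def N_map_props stable_append_ones)

lemma N_mem: "w \<in> lists S \<Longrightarrow> N w \<in> lists S"
  by (rule stable_mem[OF stable_N])

text \<open>A stable word is a stable word without \<open>1\<close> followed by a block of letters
  \<open>1\<close>. The product determines the first part by \<open>stable_unique\<close>, and the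
  length then determines the block.\<close>

lemma N_eqI:
  assumes "w \<in> lists S" "stable v" "length v = length w" "prod_list v = prod_list w"
  shows "N w = v"
proof -
  obtain u m where u: "v = u @ replicate m 1" "stable u" "1 \<notin> set u"
    using stable_split_ones[OF assms(2)] by blast
  have "N_map \<phi> w = u"
    using N_map_props[OF assms(1)] u assms(4) by (intro stable_unique) auto
  then show ?thesis using u assms(3) by (simp add: N'_map_def)
qed

lemma N_eq_self_iff: "w \<in> lists S \<Longrightarrow> N w = w \<longleftrightarrow> stable w"
  by (metis N_eqI stable_N)

lemma N_pair:
  assumes "s \<in> S" "t \<in> S"
  shows "N [s, t] = [fst (\<phi> (s, t)), snd (\<phi> (s, t))]"
  using assms phi_mem phi_mult phi_idem by (intro N_eqI) (auto simp: stable_Cons)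

lemma N_bar_eq: "s \<in> S \<Longrightarrow> t \<in> S \<Longrightarrow> N_bar N (s, t) = \<phi> (s, t)"
  by (simp add: N_bar_def N_pair)

lemma rewrite_steps_app_seq:
  assumes "(rewrite_step \<phi>)\<^sup>*\<^sup>* w v" "w \<in> lists S"
  shows "v \<in> lists S \<and> (\<exists>is. set is \<subseteq> {1..<length w} \<and> v = app_seq (N_bar N) is w)"
  using assms
proof (induction rule: rtranclp_induct)
  case base
  then show ?case by (intro conjI exI[of _ "[]"]) (auto simp: app_seq_def)
next
  case (step v v')
  then obtain "is" where "is": "set is \<subseteq> {1..<length w}" "v = app_seq (N_bar N) is w"
    and v: "v \<in> lists S" by blast
  from step.hyps(2) show ?case
  proof cases
    case (1 x a b y)
    have ab: "a \<in> S" "b \<in> S" using v 1 by auto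
    \<comment> \<open>Positions count from 1, so the factor after the prefix \<open>x\<close> sits
      at \<open>Suc (length x)\<close>.\<close>
    have "v' = app_at (N_bar N) (Suc (length x)) v"
      using 1 ab by (simp add: app_at_append N_bar_eq)
    then have "v' = app_seq (N_bar N) (is @ [Suc (length x)]) w"
      using "is" by (simp add: app_seq_def)
    moreover have "length w = length v" using "is" by simp
    then have "Suc (length x) < length w" unfolding 1(1) by simp
    then have "set (is @ [Suc (length x)]) \<subseteq> {1..<length w}" using "is" by auto
    moreover have "v' \<in> lists S" using v 1 phi_mem[OF ab] by auto
    ultimately show ?thesis by blast
  qed
qed

lemma N_app_seq:
  assumes "w \<in> lists S"
  shows "\<exists>is. set is \<subseteq> {1..<length w} \<and> N w = app_seq (N_bar N) is w"
proof -
  obtain m where "(rewrite_step \<phi>)\<^sup>*\<^sup>* w (N_map \<phi> w @ replicate m 1)"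
    using rewrite_steps_N_map[OF assms] by blast
  from rewrite_steps_app_seq[OF this assms] obtain "is" where
    "is": "set is \<subseteq> {1..<length w}" "N_map \<phi> w @ replicate m 1 = app_seq (N_bar N) is w"
    by blast
  then have "length (N_map \<phi> w @ replicate m 1) = length w" by simp
  \<comment> \<open>Equality of lengths forces \<open>m\<close> to be the amount of padding in
    \<open>N'_map\<close>.\<close>
  then have "N w = N_map \<phi> w @ replicate m 1" by (auto simp: N'_map_def)
  then show ?thesis using "is" by auto
qed

section \<open>Quadratic normalisation and the neutral letter\<close>

lemma normalisation_N: "normalisation S N"
  unfolding normalisation_def
proof (intro conjI ballI)
  fix a assume "a \<in> S"
  then show "N [a] = [a]" by (intro N_eqI) (auto simp: stable_Cons)
next
  fix u v w assume uvw: "u \<in> lists S" "v \<in> lists S" "w \<in> lists S"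
  then have Nv: "N v \<in> lists S" by (intro N_mem)
  show "N (u @ v @ w) = N (u @ N v @ w)"
  proof (rule N_eqI)
    show "stable (N (u @ N v @ w))" using uvw Nv by (intro stable_N) simp
    show "prod_list (N (u @ N v @ w)) = prod_list (u @ v @ w)"
      using uvw Nv by (simp add: prod_list_N)
  qed (use uvw in auto)
qed (use N_mem in auto)

lemma quadratic_normalisation_N: "quadratic_normalisation S N"
  unfolding quadratic_normalisation_def
proof (intro conjI ballI)
  fix w assume w: "w \<in> lists S"
  have "normal_word N [a, b] \<longleftrightarrow> \<phi> (a, b) = (a, b)" if "w = u @ [a, b] @ v" for u a b v
    using w that by (simp add: normal_word_def N_pair prod_eq_iff)
  then show "normal_word N w \<longleftrightarrow> (\<forall>u a b v. w = u @ [a, b] @ v \<longrightarrow> normal_word N [a, b])"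
    using w by (auto simp: normal_word_def N_eq_self_iff stable_def successively_iff_factors)
qed (use normalisation_N N_app_seq in auto)

lemma neutral_N: "neutral S N 1"
  unfolding neutral_def
proof (intro conjI ballI)
  fix w assume w: "w \<in> lists S"
  \<comment> \<open>This one stable word has the length and the product of both
    \<open>w @ [1]\<close> and \<open>[1] @ w\<close>.\<close>
  have *: "stable (N w @ [1])" using stable_append_ones[OF stable_N[OF w], of 1] by simp
  show "N (w @ [1]) = N w @ [1]" "N ([1] @ w) = N w @ [1]"
    using w one_mem * by (auto intro!: N_eqI simp: prod_list_N[OF w])
qed (rule one_mem)

section \<open>The presentation of the monoid\<close>

text \<open>The relations connect each word \<open>w\<close> to \<open>N w\<close>, and then to
  \<open>N_map \<phi> w\<close> by deleting the padding. Words with equal products share this last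
  word by \<open>stable_unique\<close>, which gives completeness.\<close>

lemma presented_by_N: "presented_by S ({(w, N w) | w. w \<in> lists S} \<union> {([1], [])})"
  (is "presented_by S ?R")
proof (rule presented_byI[OF generates])
  let ?C = "generated_congruence S ?R"
  show "prod_list u = prod_list v" if "(u, v) \<in> ?R" for u v
    using that prod_list_N by fastforce
  have ones: "(w @ replicate m 1, w) \<in> ?C" if "w \<in> lists S" for w m
  proof (induction m)
    case 0
    then show ?case using that by (auto intro: generated_congruence.refl)
  next
    case (Suc m)
    have "([1], []) \<in> ?C" using one_mem by (intro generated_congruence.base) auto
    from generated_congruence.cong[OF Suc this] show ?case
      by (simp add: replicate_append_same)
  qed
  have N_map: "(w, N_map \<phi> w) \<in> ?C" if w: "w \<in> lists S" for w
  proof (rule generated_congruence.trans)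
    show "(w, N w) \<in> ?C" using w N_mem[OF w] by (intro generated_congruence.base) auto
    obtain m where Nw: "N w = N_map \<phi> w @ replicate m 1" unfolding N'_map_def by blast
    have "stable (N_map \<phi> w)" using N_map_props[OF w] by blast
    from ones[OF stable_mem[OF this], of m] show "(N w, N_map \<phi> w) \<in> ?C" unfolding Nw .
  qed
  fix u v assume uv: "u \<in> lists S" "v \<in> lists S" "prod_list u = prod_list v"
  then have "N_map \<phi> u = N_map \<phi> v"
    using N_map_props[of u] N_map_props[of v] by (intro stable_unique) auto
  with N_map[OF uv(1)] have "(u, N_map \<phi> v) \<in> ?C" by simp
  from generated_congruence.trans[OF this generated_congruence.sym[OF N_map[OF uv(2)]]]
  show "(u, v) \<in> ?C" .
qed

lemma normalisation_mod_1_N: "normalisation_mod_1 S N"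
  unfolding normalisation_mod_1_def using normalisation_N neutral_N presented_by_N by blast

section \<open>The class (4, 3)\<close>

text \<open>On words over \<open>S\<close> the three pair maps agree at every position, so the
  factorability condition and the class conditions can both be read in terms of \<phi>.\<close>

lemma app_at_phi:
  assumes "w \<in> lists S"
  shows "app_at \<phi> i w \<in> lists S" "prod_list (app_at \<phi> i w) = prod_list w"
    "app_at (N_bar N) i w = app_at \<phi> i w" "app_at (\<eta> \<circ> mult_pair) i w = app_at \<phi> i w"
proof -
  have "app_at \<phi> i w \<in> lists S \<and> prod_list (app_at \<phi> i w) = prod_list w \<and>
    app_at (N_bar N) i w = app_at \<phi> i w \<and> app_at (\<eta> \<circ> mult_pair) i w = app_at \<phi> i w"
  proof (cases "1 \<le> i \<and> i < length w")
    case True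
    define u v where "u = take (i - 1) w" and "v = drop (i + 1) w"
    have w: "w = u @ w ! (i - 1) # w ! i # v" and i: "i = Suc (length u)"
      using True id_take_nth_drop[of "i - 1" w] Cons_nth_drop_Suc[of i w] by (auto simp: u_def v_def)
    obtain a b where w: "w = u @ a # b # v" using w by blast
    have ab: "a \<in> S" "b \<in> S" and uv: "u \<in> lists S" "v \<in> lists S" using assms w by auto
    have "(\<eta> \<circ> mult_pair) (a, b) = \<phi> (a, b)" using ab by (simp add: phi_eta mult_pair_def)
    then show ?thesis
      using phi_mem[OF ab] phi_mult[OF ab] N_bar_eq[OF ab] uv
      unfolding w i app_at_append by (auto simp: mult.assoc[symmetric])
  qed (use assms in \<open>auto simp: app_at_def\<close>)
  then show "app_at \<phi> i w \<in> lists S" "prod_list (app_at \<phi> i w) = prod_list w"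
    "app_at (N_bar N) i w = app_at \<phi> i w" "app_at (\<eta> \<circ> mult_pair) i w = app_at \<phi> i w"
    by auto
qed

end

locale factorable_class_4_3 = factorable +
  assumes phi_1212: "\<And>r s t. r \<in> S - {1} \<Longrightarrow> s \<in> S - {1} \<Longrightarrow> t \<in> S - {1} \<Longrightarrow>
     1 \<in> set (app_at \<phi> 2 (app_at \<phi> 1 (app_at \<phi> 2 [r, s, t]))) \<Longrightarrow>
     app_at \<phi> 1 (app_at \<phi> 2 (app_at \<phi> 1 (app_at \<phi> 2 [r, s, t]))) =
     app_at \<phi> 2 (app_at \<phi> 1 (app_at \<phi> 2 [r, s, t]))"
begin

text \<open>For nontrivial letters, the last pair of the result is fixed by idempotence. The first
  pair is fixed by the hypothesis if the result contains \<open>1\<close>, and by the factorability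
  condition otherwise.\<close>

lemma stable_phi_212:
  assumes S: "r \<in> S" "s \<in> S" "t \<in> S"
  shows "stable (app_at \<phi> 2 (app_at \<phi> 1 (app_at \<phi> 2 [r, s, t])))"
proof (cases "1 \<in> {r, s, t}")
  case True
  then consider "r = 1" | "s = 1" | "t = 1" by auto
  then show ?thesis
    \<comment> \<open>In each case the \<open>1\<close> ends up last and the result is
      \<open>[a, b, 1]\<close>, with \<open>(a, b)\<close> the value of \<phi> at the other two
      letters.\<close>
    using S one_mem phi_mem phi_idem
    by cases (simp_all add: app_at_1 app_at_2 phi_one stable_Cons)
next
  case False
  define x where "x = [r, s, t]"
  define y where "y = app_at \<phi> 1 (app_at \<phi> 2 x)"
  define z where "z = app_at \<phi> 2 y"
  have x: "x \<in> lists S" using S by (simp add: x_def)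
  have y: "y \<in> lists S" and z: "z \<in> lists S"
    unfolding z_def y_def by (intro app_at_phi x)+
  have 1: "app_at \<phi> 1 z = z"
  proof (cases "1 \<in> set z")
    case True
    then show ?thesis using phi_1212[of r s t] S False by (simp add: z_def y_def x_def)
  next
    assume no1: "1 \<notin> set z"
    have len: "total_wlen S w = length w" if "w \<in> lists S" "1 \<notin> set w" for w
      using that by (induction w) (auto simp: total_wlen_def wlen_letter)
    \<comment> \<open>Both words consist of three nontrivial letters, so the length-reducing
      alternative is excluded.\<close>
    have "total_wlen S z = total_wlen S x"
      using len[OF z no1] len[OF x] False by (simp add: z_def y_def x_def)
    moreover have "app_at (\<eta> \<circ> mult_pair) 2 (app_at (\<eta> \<circ> mult_pair) 1
        (app_at (\<eta> \<circ> mult_pair) 2 x)) = z"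
      using x by (simp add: z_def y_def app_at_phi)
    moreover have "length x = 3" by (simp add: x_def)
    ultimately have "app_at (\<eta> \<circ> mult_pair) 1 z = z"
      using factorability_cases[OF _ HOL.refl HOL.refl, of x] by (metis less_irrefl)
    then show ?thesis using z by (simp add: app_at_phi)
  qed
  have "length y = 3" by (simp add: y_def x_def)
  then obtain a b c where abc: "y = [a, b, c]"
    by (auto simp: numeral_3_eq_3 length_Suc_conv)
  have "b \<in> S" "c \<in> S" using y abc by auto
  moreover obtain d e where de: "\<phi> (b, c) = (d, e)" by fastforce
  ultimately have "\<phi> (d, e) = (d, e)" by (intro phi(4))
  moreover have "z = [a, d, e]" by (simp add: z_def abc app_at_2 de)
  ultimately have "stable z" using 1 z by (auto simp: app_at_1 stable_Cons prod_eq_iff)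
  then show ?thesis by (simp add: z_def y_def x_def)
qed

lemma N_triple:
  assumes "w \<in> lists S" "length w = 3"
  shows "N w = app_at \<phi> 2 (app_at \<phi> 1 (app_at \<phi> 2 w))"
proof -
  obtain r s t where w: "w = [r, s, t]"
    using assms(2) by (auto simp: numeral_3_eq_3 length_Suc_conv)
  show ?thesis
    using assms stable_phi_212[of r s t]
    by (intro N_eqI) (auto simp: w app_at_phi)
qed

lemma quadratic_normalisation_of_class_N: "quadratic_normalisation_of_class S N (4, 3)"
proof -
  have "left_class S N 4"
    unfolding left_class_def
  proof (intro ballI impI)
    fix w assume w: "w \<in> lists S" "length w = 3"
    \<comment> \<open>Applying \<phi> at position 1 keeps length and product, hence the value of
      \<open>N\<close>. The left class is thus the right-class formula applied after one extra
      map.\<close>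
    have "N w = N (app_at \<phi> 1 w)"
      using w app_at_phi[OF w(1), of 1]
      by (intro N_eqI) (auto simp: stable_N prod_list_N)
    also have "\<dots> = app_at \<phi> 2 (app_at \<phi> 1 (app_at \<phi> 2 (app_at \<phi> 1 w)))"
      using w by (intro N_triple app_at_phi) auto
    finally show "N w = app_seq (N_bar N) (map (\<lambda>k. if even k then 1 else 2) [0..<4]) w"
      using w by (simp add: app_seq_def upt_rec app_at_phi)
  qed
  moreover have "right_class S N 3"
    unfolding right_class_def
    by (auto simp: N_triple app_seq_def upt_rec app_at_phi)
  ultimately show ?thesis
    using quadratic_normalisation_N by (simp add: quadratic_normalisation_of_class_def)
qed

end

theorem proposition4p2p3:
  fixes S :: "'a::monoid_mult set"
    and \<eta> :: "'a \<Rightarrow> 'a \<times> 'a"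
    and \<phi> :: "'a \<times> 'a \<Rightarrow> 'a \<times> 'a"
  assumes "factorable_monoid S \<eta>"
    and "\<phi> = restrict (\<eta> \<circ> mult_pair) (S \<times> S)"
    and "\<And>r s t. r \<in> S - {1} \<Longrightarrow> s \<in> S - {1} \<Longrightarrow> t \<in> S - {1} \<Longrightarrow>
           1 \<in> set (app_at \<phi> 2 (app_at \<phi> 1 (app_at \<phi> 2 [r, s, t]))) \<Longrightarrow>
           app_at \<phi> 1 (app_at \<phi> 2 (app_at \<phi> 1 (app_at \<phi> 2 [r, s, t]))) =
           app_at \<phi> 2 (app_at \<phi> 1 (app_at \<phi> 2 [r, s, t]))"
  shows "quadratic_normalisation_of_class S (N'_map \<phi>) (4, 3) \<and>
         normalisation_mod_1 S (N'_map \<phi>)"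
proof -
  interpret factorable_class_4_3 S \<eta> \<phi>
    by unfold_locales (fact assms)+
  show ?thesis
    using quadratic_normalisation_of_class_N normalisation_mod_1_N by blast
qed

end
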